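(* Let $\omega\ne0$. Then there exists $\mu_0\in(0,\infty)$ such that if $\mu\ge\mu_0$, then $\mathcal{E}_\mu(\theta_c,\rho_c)<\mathcal{E}_\mu(\theta,\rho)$ for all $(\theta,\rho)\in\mathcal{A}$ with $\int_0^L\theta\,\mathrm{d}s=\pi\omega L$ and $(\theta,\rho)\ne(\theta_c,\rho_c)$, where $\theta_c(s)=\frac{2\pi\omega}{L}s$ and $\rho_c\equiv\nu$.
   Context: Parameters: $L>0$, $\nu\in\mathbb{R}$, $\omega\in\mathbb{Z}$, $c_0\in\mathbb{R}$ and $\beta\in C^\infty(\mathbb{R})$ with $\beta>0$ are fixed; $\mu>0$. The energy is $$\mathcal{E}_\mu(\theta,\rho)=\frac12\int_0^L\big(\beta(\rho)(\partial_s\theta-c_0)^2+\mu(\partial_s\rho)^2\big)\,\mathrm{d}s.$$ The admissible set is $$\mathcal{A}=\Big\{(\theta,\rho)\in W^{1,2}(0,L;\mathbb{R}^2):\ \theta(L)-\theta(0)=2\pi\omega,\ \rho(L)=\rho(0),\ \int_0^L\cos\theta\,\mathrm{d}s=\int_0^L\sin\theta\,\mathrm{d}s=0,\ \int_0^L\rho\,\mathrm{d}s=\nu L\Big\}.$$ *)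

theory Defs
  imports "HOL-Analysis.Analysis"
begin

definition smooth_real :: "(real \<Rightarrow> real) \<Rightarrow> bool" where
  "smooth_real f \<longleftrightarrow> (\<forall>k x. (deriv ^^ k) f differentiable (at x))"

text \<open>Test functions \<open>C\<^sub>c\<^sup>\<infinity>(0,L)\<close>, extended by zero to the whole line.\<close>

definition test_functions :: "real \<Rightarrow> (real \<Rightarrow> real) set" where
  "test_functions L =
     {\<phi>. smooth_real \<phi> \<and> compact (closure {x. \<phi> x \<noteq> 0}) \<and> closure {x. \<phi> x \<noteq> 0} \<subseteq> {0<..<L}}"

text \<open>
  Elements of \<open>L\<^sup>2(0,L)\<close> and \<open>W\<^sup>1\<^sup>,\<^sup>2(0,L)\<close> are represented by arbitrary functions on the line, of
  which only the values almost everywhere on the interval matter. Measurability is required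
  separately, since integrability of the square does not imply it.
\<close>

definition L2 :: "real \<Rightarrow> (real \<Rightarrow> real) set" where
  "L2 L = {f. set_borel_measurable lebesgue {0<..<L} f \<and>
              set_integrable lebesgue {0<..<L} (\<lambda>x. (f x)\<^sup>2)}"

definition has_weak_deriv :: "real \<Rightarrow> (real \<Rightarrow> real) \<Rightarrow> (real \<Rightarrow> real) \<Rightarrow> bool" where
  "has_weak_deriv L f g \<longleftrightarrow>
     f \<in> L2 L \<and> g \<in> L2 L \<and>
     (\<forall>\<phi>\<in>test_functions L.
        (LINT x:{0<..<L}|lebesgue. f x * deriv \<phi> x) = - (LINT x:{0<..<L}|lebesgue. g x * \<phi> x))"

definition W12 :: "real \<Rightarrow> (real \<Rightarrow> real) set" where
  "W12 L = {f. \<exists>g. has_weak_deriv L f g}"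

text \<open>The weak derivative is unique up to null sets; any version may be chosen.\<close>

definition weak_deriv :: "real \<Rightarrow> (real \<Rightarrow> real) \<Rightarrow> real \<Rightarrow> real" where
  "weak_deriv L f = (SOME g. has_weak_deriv L f g)"

definition ae_eq :: "real \<Rightarrow> (real \<Rightarrow> real) \<Rightarrow> (real \<Rightarrow> real) \<Rightarrow> bool" where
  "ae_eq L f g \<longleftrightarrow> (AE x\<in>{0<..<L} in lebesgue. f x = g x)"

definition continuous_rep :: "real \<Rightarrow> (real \<Rightarrow> real) \<Rightarrow> (real \<Rightarrow> real) \<Rightarrow> bool" where
  "continuous_rep L f g \<longleftrightarrow> continuous_on {0..L} g \<and> ae_eq L f g"

definition energy ::
  "real \<Rightarrow> (real \<Rightarrow> real) \<Rightarrow> real \<Rightarrow> real \<Rightarrow> (real \<Rightarrow> real) \<times> (real \<Rightarrow> real) \<Rightarrow> real" where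
  "energy L \<beta> c\<^sub>0 \<mu> = (\<lambda>(\<theta>, \<rho>).
     1 / 2 * (LINT s:{0<..<L}|lebesgue.
       \<beta> (\<rho> s) * (weak_deriv L \<theta> s - c\<^sub>0)\<^sup>2 + \<mu> * (weak_deriv L \<rho> s)\<^sup>2))"

text \<open>
  The boundary values of a class in \<open>W\<^sup>1\<^sup>,\<^sup>2(0,L)\<close> are those of its continuous representative on
  the closed interval, which exists and is unique there.
\<close>

definition admissible ::
  "real \<Rightarrow> real \<Rightarrow> int \<Rightarrow> ((real \<Rightarrow> real) \<times> (real \<Rightarrow> real)) set" where
  "admissible L \<nu> \<omega> =
     {(\<theta>, \<rho>). \<theta> \<in> W12 L \<and> \<rho> \<in> W12 L \<and>
        (\<exists>\<theta>'. continuous_rep L \<theta> \<theta>' \<and> \<theta>' L - \<theta>' 0 = 2 * pi * of_int \<omega>) \<and>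
        (\<exists>\<rho>'. continuous_rep L \<rho> \<rho>' \<and> \<rho>' L = \<rho>' 0) \<and>
        (LINT s:{0<..<L}|lebesgue. cos (\<theta> s)) = 0 \<and>
        (LINT s:{0<..<L}|lebesgue. sin (\<theta> s)) = 0 \<and>
        (LINT s:{0<..<L}|lebesgue. \<rho> s) = \<nu> * L}"

definition theta_c :: "real \<Rightarrow> int \<Rightarrow> real \<Rightarrow> real" where
  "theta_c L \<omega> = (\<lambda>s. 2 * pi * of_int \<omega> / L * s)"

definition rho_c :: "real \<Rightarrow> real \<Rightarrow> real" where
  "rho_c \<nu> = (\<lambda>s. \<nu>)"

end

theory Submission
  imports Defs
begin

text \<open>
  Put \<open>A = 2\<pi>\<omega>/L - c\<^sub>0\<close>, \<open>t = \<beta>(\<nu>) A\<close> and \<open>p = \<theta>' - c\<^sub>0\<close>. Since \<open>\<beta>(\<rho>) p\<^sup>2\<close> is convex in \<open>p\<close>, it lies above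
  its tangent \<open>2 t p - t\<^sup>2 / \<beta>(\<rho>)\<close>, and the integral of \<open>p\<close> is \<open>A L\<close> for every competitor.
  Expanding \<open>1/\<beta>\<close> to second order at \<open>\<nu>\<close>, the linear term drops out because \<open>\<rho>\<close> has mean \<open>\<nu>\<close>, and
  the quadratic one is at most a constant times the integral of \<open>\<rho>'\<^sup>2\<close> by a Poincare inequality; so it
  is absorbed by \<open>\<mu> \<rho>'\<^sup>2\<close> when \<open>\<mu>\<close> is large. If the integral of \<open>\<rho>'\<^sup>2\<close> exceeds \<open>1\<close>, the term \<open>\<mu> \<rho>'\<^sup>2\<close>
  alone beats the energy of the critical point. Equality forces \<open>\<rho> = \<nu>\<close> and \<open>\<theta>'\<close> constant, and the
  prescribed mean of \<open>\<theta>\<close> then leaves only \<open>\<theta>\<^sub>c\<close>.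
\<close>

section \<open>Smooth functions of one variable\<close>

text \<open>The count is such that order 0 already means differentiable. The recursion peels off the
  innermost \<open>deriv\<close>, so an induction hypothesis for arbitrary functions applies to
  \<open>deriv f\<close>, whereas \<open>deriv ^^ Suc k\<close> unfolds from the outside.\<close>

primrec ndifferentiable :: "nat \<Rightarrow> (real \<Rightarrow> real) \<Rightarrow> bool" where
  "ndifferentiable 0 f \<longleftrightarrow> (\<forall>x. f differentiable (at x))"
| "ndifferentiable (Suc n) f \<longleftrightarrow> (\<forall>x. f differentiable (at x)) \<and> ndifferentiable n (deriv f)"

lemma ndifferentiable_iff:
  "ndifferentiable n f \<longleftrightarrow> (\<forall>k\<le>n. \<forall>x. (deriv ^^ k) f differentiable (at x))"
proof (induction n arbitrary: f)
  case 0
  then show ?case by simp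
next
  case (Suc n)
  have "(\<forall>k\<le>Suc n. \<forall>x. (deriv ^^ k) f differentiable (at x)) \<longleftrightarrow>
        (\<forall>x. f differentiable (at x)) \<and> (\<forall>k\<le>n. \<forall>x. (deriv ^^ Suc k) f differentiable (at x))"
    (is "(\<forall>k\<le>Suc n. ?P k) \<longleftrightarrow> _")
    by (metis (mono_tags, lifting) Suc_le_mono bot_nat_0.extremum funpow_0 not0_implies_Suc)
  then show ?case
    using Suc.IH[of "deriv f"] by (simp add: funpow_Suc_right del: funpow.simps)
qed

lemma smooth_real_iff: "smooth_real f \<longleftrightarrow> (\<forall>n. ndifferentiable n f)"
  unfolding smooth_real_def ndifferentiable_iff by blast

lemma ndifferentiable_imp_differentiable: "ndifferentiable n f \<Longrightarrow> f differentiable (at x)"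
  by (cases n) auto

lemma ndifferentiable_imp_DERIV: "ndifferentiable n f \<Longrightarrow> (f has_real_derivative deriv f x) (at x)"
  using ndifferentiable_imp_differentiable DERIV_deriv_iff_real_differentiable by blast

lemma ndifferentiable_SucD: "ndifferentiable (Suc n) f \<Longrightarrow> ndifferentiable n f"
  by (simp add: ndifferentiable_iff)

text \<open>The induction step in usable form: a derivative given by an explicit formula replaces
  \<open>deriv f\<close>.\<close>

lemma ndifferentiable_SucI:
  assumes "\<And>x. (f has_real_derivative f' x) (at x)" and "ndifferentiable n f'"
  shows "ndifferentiable (Suc n) f"
proof -
  have "deriv f = f'"
    using assms(1) by (auto intro: DERIV_imp_deriv)
  then show ?thesis
    using assms real_differentiable_def by auto
qed

lemma ndifferentiable_0I: "(\<And>x. (f has_real_derivative f' x) (at x)) \<Longrightarrow> ndifferentiable 0 f"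
  using real_differentiable_def by auto

lemma ndifferentiable_const: "ndifferentiable n (\<lambda>x. c)"
proof (induction n arbitrary: c)
  case (Suc n)
  show ?case by (rule ndifferentiable_SucI[where f' = "\<lambda>x. 0"]) (auto intro: Suc)
qed auto

lemma ndifferentiable_add:
  "ndifferentiable n f \<Longrightarrow> ndifferentiable n g \<Longrightarrow> ndifferentiable n (\<lambda>x. f x + g x)"
proof (induction n arbitrary: f g)
  case (Suc n)
  show ?case
  proof (rule ndifferentiable_SucI)
    show "((\<lambda>x. f x + g x) has_real_derivative deriv f x + deriv g x) (at x)" for x
      using Suc.prems by (intro DERIV_add ndifferentiable_imp_DERIV)
    show "ndifferentiable n (\<lambda>x. deriv f x + deriv g x)"
      using Suc by simp
  qed
qed auto

text \<open>The product rule gives a sum of products again; its undifferentiated factors are lowered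
  by one order with \<open>ndifferentiable_SucD\<close>.\<close>

lemma ndifferentiable_mult:
  "ndifferentiable n f \<Longrightarrow> ndifferentiable n g \<Longrightarrow> ndifferentiable n (\<lambda>x. f x * g x)"
proof (induction n arbitrary: f g)
  case (Suc n)
  show ?case
  proof (rule ndifferentiable_SucI)
    show "((\<lambda>x. f x * g x) has_real_derivative deriv f x * g x + deriv g x * f x) (at x)" for x
      using Suc.prems by (intro DERIV_mult ndifferentiable_imp_DERIV)
    show "ndifferentiable n (\<lambda>x. deriv f x * g x + deriv g x * f x)"
      using Suc.prems by (intro ndifferentiable_add Suc.IH)
        (auto intro: ndifferentiable_SucD simp del: ndifferentiable.simps(2)
          simp: ndifferentiable.simps(2)[of n f] ndifferentiable.simps(2)[of n g])
  qed
qed auto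

text \<open>The derivative is a polynomial in \<open>deriv f x\<close> and
  \<open>inverse (f x)\<close> itself, so the induction hypothesis for the same function at order
  \<open>n\<close> suffices.\<close>

lemma ndifferentiable_inverse:
  assumes "ndifferentiable n f" and nz: "\<And>x. f x \<noteq> 0"
  shows "ndifferentiable n (\<lambda>x. inverse (f x))"
  using assms(1)
proof (induction n)
  case 0
  then show ?case using nz by (auto intro: differentiable_inverse)
next
  case (Suc n)
  have inv: "ndifferentiable n (\<lambda>x. inverse (f x))"
    using Suc ndifferentiable_SucD by blast
  show ?case
  proof (rule ndifferentiable_SucI)
    show "((\<lambda>x. inverse (f x)) has_real_derivative
        (-1) * (deriv f x * (inverse (f x) * inverse (f x)))) (at x)" for x
      using DERIV_inverse'[OF ndifferentiable_imp_DERIV[OF Suc.prems] nz, of x]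
      by (simp add: mult_ac)
    show "ndifferentiable n (\<lambda>x. (-1) * (deriv f x * (inverse (f x) * inverse (f x))))"
      using Suc.prems by (intro ndifferentiable_mult ndifferentiable_const inv) auto
  qed
qed

text \<open>The derivative is a constant times \<open>deriv f\<close> composed with the same affine
  map, so no higher-order chain rule arises. Reflections, shifts and dilations of the step function
  below have this form.\<close>

lemma ndifferentiable_compose_affine:
  "ndifferentiable n f \<Longrightarrow> ndifferentiable n (\<lambda>x. f (a * x + b))"
proof (induction n arbitrary: f)
  case 0
  have "((\<lambda>x. f (a * x + b)) has_real_derivative deriv f (a * x + b) * a) (at x)" for x
    by (rule DERIV_chain2[OF ndifferentiable_imp_DERIV[OF 0]]) (auto intro!: derivative_eq_intros)
  then show ?case by (rule ndifferentiable_0I)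
next
  case (Suc n)
  show ?case
  proof (rule ndifferentiable_SucI)
    show "((\<lambda>x. f (a * x + b)) has_real_derivative deriv f (a * x + b) * a) (at x)" for x
      by (rule DERIV_chain2[OF ndifferentiable_imp_DERIV[OF Suc.prems]])
        (auto intro!: derivative_eq_intros)
    show "ndifferentiable n (\<lambda>x. deriv f (a * x + b) * a)"
      using Suc by (intro ndifferentiable_mult ndifferentiable_const) auto
  qed
qed

lemma smooth_real_const: "smooth_real (\<lambda>x. c)"
  by (simp add: smooth_real_iff ndifferentiable_const)

lemma smooth_real_add: "smooth_real f \<Longrightarrow> smooth_real g \<Longrightarrow> smooth_real (\<lambda>x. f x + g x)"
  by (simp add: smooth_real_iff ndifferentiable_add)

lemma smooth_real_mult: "smooth_real f \<Longrightarrow> smooth_real g \<Longrightarrow> smooth_real (\<lambda>x. f x * g x)"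
  by (simp add: smooth_real_iff ndifferentiable_mult)

lemma smooth_real_inverse:
  "smooth_real f \<Longrightarrow> (\<And>x. f x \<noteq> 0) \<Longrightarrow> smooth_real (\<lambda>x. inverse (f x))"
  by (simp add: smooth_real_iff ndifferentiable_inverse)

lemma smooth_real_diff: "smooth_real f \<Longrightarrow> smooth_real g \<Longrightarrow> smooth_real (\<lambda>x. f x - g x)"
  using smooth_real_add[of f "\<lambda>x. (-1) * g x"] smooth_real_mult[OF smooth_real_const[of "-1"], of g]
  by simp

lemma smooth_real_compose_affine: "smooth_real f \<Longrightarrow> smooth_real (\<lambda>x. f (a * x + b))"
  by (simp add: smooth_real_iff ndifferentiable_compose_affine)

lemma smooth_real_DERIV: "smooth_real f \<Longrightarrow> (f has_real_derivative deriv f x) (at x)"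
  using smooth_real_iff ndifferentiable_imp_DERIV by blast

lemma smooth_real_deriv: "smooth_real f \<Longrightarrow> smooth_real (deriv f)"
  using smooth_real_iff ndifferentiable.simps(2) by blast

lemma smooth_real_continuous_on: "smooth_real f \<Longrightarrow> continuous_on S f"
  using smooth_real_DERIV DERIV_isCont continuous_at_imp_continuous_on by blast

section \<open>A smooth step function built from exp(-1/x)\<close>

lemma tendsto_inverse_power_exp_inverse:
  "((\<lambda>x::real. inverse x ^ k * exp (- inverse x)) \<longlongrightarrow> 0) (at_right 0)"
proof -
  have "((\<lambda>t. t ^ k / exp t) \<longlongrightarrow> (0::real)) at_top"
    by (rule tendsto_power_div_exp_0)
  from filterlim_compose[OF this filterlim_inverse_at_top_right]
  show ?thesis
    by (simp add: exp_minus field_simps)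
qed

text \<open>The factor \<open>x\<^sup>-\<^sup>k\<close> makes the family closed under differentiation up to linear combinations.\<close>

definition flat :: "nat \<Rightarrow> real \<Rightarrow> real" where
  "flat k x = (if x > 0 then inverse x ^ k * exp (- inverse x) else 0)"

text \<open>Away from 0 this is calculus on each half line. At 0 the right difference quotient is
  \<open>inverse h ^ Suc k * exp (- inverse h)\<close>, which tends to 0, and the left one
  vanishes.\<close>

lemma flat_DERIV:
  "(flat k has_real_derivative flat (k + 2) x + (- real k) * flat (k + 1) x) (at x)"
proof -
  consider "x < 0" | "x > 0" | "x = 0" by linarith
  then show ?thesis
  proof cases
    case 1
    have "((\<lambda>x. 0) has_real_derivative 0) (at x)" by simp
    then have "(flat k has_real_derivative 0) (at x)"
      by (rule has_field_derivative_transform_within_open[where S = "{..<0}"])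
        (use 1 in \<open>auto simp: flat_def\<close>)
    then show ?thesis using 1 by (simp add: flat_def)
  next
    case 2
    have exp: "((\<lambda>x. exp (- inverse x)) has_real_derivative exp (- inverse x) * (inverse x)\<^sup>2) (at x)"
      using 2 by (auto intro!: derivative_eq_intros simp: power2_eq_square)
    have pow: "((\<lambda>x. inverse x ^ k) has_real_derivative - real k * inverse x ^ (k + 1)) (at x)"
      using DERIV_power[OF DERIV_inverse[of x UNIV], of k] 2
      by (cases k) (simp_all add: numeral_2_eq_2 algebra_simps)
    have "((\<lambda>x. inverse x ^ k * exp (- inverse x)) has_real_derivative
      flat (k + 2) x + (- real k) * flat (k + 1) x) (at x)"
      using DERIV_mult[OF pow exp] 2 by (simp add: flat_def power_add power2_eq_square mult_ac add.commute)
    then show ?thesis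
      by (rule has_field_derivative_transform_within_open[where S = "{0<..}"])
        (use 2 in \<open>auto simp: flat_def\<close>)
  next
    case 3
    have "((\<lambda>h. flat k h / h) \<longlongrightarrow> 0) (at 0)"
    proof (subst filterlim_at_split, intro conjI)
      show "((\<lambda>h. flat k h / h) \<longlongrightarrow> 0) (at_left 0)"
        by (rule tendsto_eventually) (auto simp: eventually_at_filter flat_def)
      show "((\<lambda>h. flat k h / h) \<longlongrightarrow> 0) (at_right 0)"
        by (rule Lim_transform_eventually[OF tendsto_inverse_power_exp_inverse[of "Suc k"]])
          (auto simp: eventually_at_filter flat_def field_simps)
    qed
    then show ?thesis
      unfolding 3 by (simp add: DERIV_def flat_def)
  qed
qed

lemma smooth_real_flat: "smooth_real (flat k)"
proof -
  have "ndifferentiable n (flat k)" for n k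
  proof (induction n arbitrary: k)
    case 0
    show ?case by (rule ndifferentiable_0I[OF flat_DERIV])
  next
    case (Suc n)
    show ?case
      by (rule ndifferentiable_SucI[OF flat_DERIV])
        (intro ndifferentiable_add ndifferentiable_mult ndifferentiable_const Suc)
  qed
  then show ?thesis by (simp add: smooth_real_iff)
qed

lemma smooth_step_exists:
  obtains \<psi> :: "real \<Rightarrow> real"
  where "smooth_real \<psi>" "\<And>x. x \<le> 0 \<Longrightarrow> \<psi> x = 0" "\<And>x. x \<ge> 1 \<Longrightarrow> \<psi> x = 1" "\<And>x. \<bar>\<psi> x\<bar> \<le> 1"
proof
  \<comment> \<open>Positive everywhere, since \<open>x\<close> and \<open>1 - x\<close> cannot both
    be nonpositive; it serves as the normalising denominator. The second argument is written in the
    shape of \<open>smooth_real_compose_affine\<close>.\<close>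
  define d where "d x = flat 0 x + flat 0 (-1 * x + 1)" for x
  have nn: "flat 0 x \<ge> 0" "x > 0 \<Longrightarrow> flat 0 x > 0" for x
    by (auto simp: flat_def)
  have d: "d x > 0" for x
    unfolding d_def using nn[of x] nn[of "-1 * x + 1"] by (cases "x > 0") auto
  define \<psi> where "\<psi> x = flat 0 x * inverse (d x)" for x
  have "smooth_real d"
    unfolding d_def by (intro smooth_real_add smooth_real_compose_affine smooth_real_flat)
  moreover have "d x \<noteq> 0" for x
    using d[of x] by simp
  ultimately show "smooth_real \<psi>"
    unfolding \<psi>_def by (intro smooth_real_mult smooth_real_inverse smooth_real_flat)
  show "\<psi> x = 0" if "x \<le> 0" for x
    using that by (simp add: \<psi>_def flat_def)
  show "\<psi> x = 1" if "x \<ge> 1" for x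
    using that d[of x] by (simp add: \<psi>_def d_def flat_def)
  show "\<bar>\<psi> x\<bar> \<le> 1" for x
    using nn[of x] nn[of "-1 * x + 1"] d[of x] by (simp add: \<psi>_def d_def abs_mult field_simps)
qed

section \<open>Weak derivatives on an interval\<close>

lemma LINT_lebesgue_on:
  fixes f :: "real \<Rightarrow> real"
  shows "(LINT x:{a<..<b}|lebesgue. f x) = integral\<^sup>L (lebesgue_on {a<..<b}) f"
  by (simp add: set_lebesgue_integral_def integral_restrict_space)

lemma finite_measure_lebesgue_on_interval: "finite_measure (lebesgue_on {a<..<b::real})"
  by (rule finite_measure_lebesgue_on) simp

lemma L2_borel_measurable: "f \<in> L2 L \<Longrightarrow> f \<in> borel_measurable (lebesgue_on {0<..<L})"
  by (simp add: L2_def set_borel_measurable_def borel_measurable_restrict_space_iff)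

lemma L2_square_integrable: "f \<in> L2 L \<Longrightarrow> integrable (lebesgue_on {0<..<L}) (\<lambda>x. (f x)\<^sup>2)"
  by (simp add: L2_def absolutely_integrable_imp_integrable)

lemma L2_integrable: "f \<in> L2 L \<Longrightarrow> integrable (lebesgue_on {0<..<L}) f"
  using finite_measure.square_integrable_imp_integrable[OF finite_measure_lebesgue_on_interval]
    L2_borel_measurable L2_square_integrable by blast

lemma L2_integrable_on:
  assumes "f \<in> L2 L"
  shows "f integrable_on {0..L}"
proof -
  have "f integrable_on {0<..<L}"
    by (intro integrable_on_lebesgue_on L2_integrable assms) simp
  then show ?thesis
    by (simp add: integrable_on_open_interval_real)
qed

lemma ae_eq_lebesgue_on: "ae_eq L f g \<longleftrightarrow> (AE x in lebesgue_on {0<..<L}. f x = g x)"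
  by (simp add: ae_eq_def AE_restrict_space_iff)

section \<open>Approximate identities and the fundamental theorem for weak derivatives\<close>

text \<open>For \<open>k > 0\<close> the kernel \<open>k * deriv \<psi> (k * (s - x))\<close> has
  integral one and lives on \<open>{x..x + 1 / k}\<close>. The substitution
  \<open>s = x + r / k\<close> moves \<open>k\<close> into the argument of the bounded continuous
  \<open>F\<close>, and dominated convergence gives the limit.\<close>

lemma
  fixes F \<psi> :: "real \<Rightarrow> real"
  assumes F: "continuous_on UNIV F" "\<And>s. \<bar>F s\<bar> \<le> B"
    and \<psi>: "smooth_real \<psi>" "\<And>x. x \<le> 0 \<Longrightarrow> \<psi> x = 0" "\<And>x. x \<ge> 1 \<Longrightarrow> \<psi> x = 1"
  shows integrable_mollifier: "k > 0 \<Longrightarrow> integrable lborel (\<lambda>s. F s * (k * deriv \<psi> (k * s + - k * x)))"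
    and mollifier_tendsto: "(\<lambda>n. LINT s|lborel. F s * (real (Suc n) * deriv \<psi> (real (Suc n) * s + - real (Suc n) * x)))
           \<longlonglongrightarrow> F x"
proof -
  \<comment> \<open>\<open>\<psi>\<close> is constant on either side of the unit interval.\<close>
  have out: "deriv \<psi> s = 0" if s: "s \<notin> {0..1}" for s
  proof (rule DERIV_imp_deriv)
    consider "s < 0" | "s > 1"
      using s by (cases "s < 0") auto
    then show "(\<psi> has_real_derivative 0) (at s)"
    proof cases
      case 1
      show ?thesis
        by (rule has_field_derivative_transform_within_open[OF DERIV_const[of 0], where S = "{..<0}"])
          (use 1 \<psi>(2) in auto)
    next
      case 2
      show ?thesis
        by (rule has_field_derivative_transform_within_open[OF DERIV_const[of 1], where S = "{1<..}"])
          (use 2 \<psi>(3) in auto)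
    qed
  qed
  have cont: "continuous_on S (deriv \<psi>)" for S
    using \<psi>(1) smooth_real_deriv smooth_real_continuous_on by blast
  have int: "integrable lborel (\<lambda>r. G r * deriv \<psi> r)" if "continuous_on UNIV G" for G
  proof -
    have "set_integrable lborel {0..1} (\<lambda>r. G r * deriv \<psi> r)"
      by (intro borel_integrable_atLeastAtMost' continuous_intros cont continuous_on_subset[OF that]) auto
    then show ?thesis
      unfolding set_integrable_def
      by (rule back_subst[where P = "integrable lborel"]) (rule ext, use out in \<open>auto simp: indicator_def\<close>)
  qed
  have Fk: "continuous_on UNIV (\<lambda>r. F (x + r / k))" for k x
    by (rule continuous_on_compose2[OF F(1)]) (auto intro!: continuous_intros simp: divide_inverse)
  \<comment> \<open>The Jacobian \<open>1 / k\<close> of the substitution will cancel the factor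
    \<open>k\<close>.\<close>
  have aff: "(\<lambda>r. F (x + (1/k) * r) * (k * deriv \<psi> (k * (x + (1/k) * r) + - k * x))) =
      (\<lambda>r. k * (F (x + r / k) * deriv \<psi> r))" if "k > 0" for k x
    using that by (auto simp: algebra_simps)
  show "integrable lborel (\<lambda>s. F s * (k * deriv \<psi> (k * s + - k * x)))" if "k > 0" for k x
    using int[OF Fk, of x k] aff[OF that, of x] that
      lborel_integrable_real_affine_iff[of "1/k" "(\<lambda>s. F s * (k * deriv \<psi> (k * s + - k * x)))" x]
    by simp
  have eq: "(LINT s|lborel. F s * (k * deriv \<psi> (k * s + - k * x))) =
      (LINT r|lborel. F (x + r / k) * deriv \<psi> r)" if "k > 0" for k
    using aff[OF that, of x] that
      lborel_integral_real_affine[of "1/k" "(\<lambda>s. F s * (k * deriv \<psi> (k * s + - k * x)))" x]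
    by simp
  have "(\<lambda>n. LINT r|lborel. F (x + r / real (Suc n)) * deriv \<psi> r) \<longlonglongrightarrow> (LINT r|lborel. F x * deriv \<psi> r)"
  proof (rule integral_dominated_convergence)
    show "integrable lborel (\<lambda>r. B * \<bar>deriv \<psi> r\<bar>)"
      using int[of "\<lambda>r. 1"] by simp
    show "(\<lambda>r. F x * deriv \<psi> r) \<in> borel_measurable lborel"
      using int[of "\<lambda>r. F x"] by (simp only: borel_measurable_integrable continuous_on_const)
    show "(\<lambda>r. F (x + r / real (Suc n)) * deriv \<psi> r) \<in> borel_measurable lborel" for n
      using int[OF Fk] borel_measurable_integrable by blast
    show "AE r in lborel. (\<lambda>n. F (x + r / real (Suc n)) * deriv \<psi> r) \<longlonglongrightarrow> F x * deriv \<psi> r"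
    proof (intro AE_I2 tendsto_mult tendsto_const)
      fix r
      have "(\<lambda>n. x + r / real (Suc n)) \<longlonglongrightarrow> x + 0"
        by (intro tendsto_add tendsto_const LIMSEQ_Suc[OF lim_const_over_n])
      then show "(\<lambda>n. F (x + r / real (Suc n))) \<longlonglongrightarrow> F x"
        using F(1) continuous_on_tendsto_compose[of UNIV F _ x sequentially] by simp
    qed
    show "AE r in lborel. norm (F (x + r / real (Suc n)) * deriv \<psi> r) \<le> B * \<bar>deriv \<psi> r\<bar>" for n
      using F(2) by (auto simp: abs_mult intro!: mult_right_mono)
  qed
  \<comment> \<open>The mass of \<open>deriv \<psi>\<close> is
    \<open>\<psi> 1 - \<psi> 0 = 1\<close>.\<close>
  moreover have "(LINT r|lborel. F x * deriv \<psi> r) = F x"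
  proof -
    have "(LINT r|lborel. deriv \<psi> r) = (LINT r|lborel. deriv \<psi> r * indicator {0..1} r)"
      by (rule Bochner_Integration.integral_cong) (use out in \<open>auto simp: indicator_def\<close>)
    also have "\<dots> = \<psi> 1 - \<psi> 0"
      using smooth_real_DERIV[OF \<psi>(1)] cont[of UNIV]
      by (intro integral_FTC_Icc_real) (auto simp: continuous_on_eq_continuous_at)
    finally show ?thesis using \<psi>(2)[of 0] \<psi>(3)[of 1] by simp
  qed
  ultimately show "(\<lambda>n. LINT s|lborel. F s * (real (Suc n) * deriv \<psi> (real (Suc n) * s + - real (Suc n) * x)))
           \<longlonglongrightarrow> F x"
    by (subst eq) (simp_all only: of_nat_0_less_iff zero_less_Suc)
qed

text \<open>
  Testing the weak derivative against smoothed indicator functions of \<open>(x, y)\<close>, whose derivatives are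
  approximate identities at \<open>x\<close> and \<open>y\<close>.
\<close>

lemma has_weak_deriv_imp_diff_interior:
  assumes weak: "has_weak_deriv L f g" and rep: "continuous_rep L f F"
    and xy: "0 < x" "x < y" "y < L"
  shows "F y - F x = integral {x..y} g"
proof -
  let ?M = "lebesgue_on {0<..<L}"
  have L2: "f \<in> L2 L" "g \<in> L2 L"
    using weak by (auto simp: has_weak_deriv_def)
  obtain \<psi> :: "real \<Rightarrow> real" where \<psi>: "smooth_real \<psi>" "\<And>x. x \<le> 0 \<Longrightarrow> \<psi> x = 0"
      "\<And>x. x \<ge> 1 \<Longrightarrow> \<psi> x = 1" "\<And>x. \<bar>\<psi> x\<bar> \<le> 1"
    using smooth_step_exists by blast
  \<comment> \<open>\<open>F\<close> is controlled only on \<open>{0..L}\<close>. Freezing it at its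
    end values outside gives a bounded continuous function on the whole line, as the mollifier
    lemmas demand.\<close>
  define G where "G s = F (max 0 (min L s))" for s
  have F: "continuous_on {0..L} F" "AE s in ?M. f s = F s"
    using rep by (auto simp: continuous_rep_def ae_eq_lebesgue_on)
  have G_eq: "G s = F s" if "s \<in> {0..L}" for s
    using that by (simp add: G_def)
  have G: "continuous_on UNIV G"
    unfolding G_def by (rule continuous_on_compose2[OF F(1)]) (use xy in \<open>auto intro!: continuous_intros\<close>)
  have "bounded (F ` {0..L})"
    using compact_continuous_image[OF F(1)] compact_imp_bounded by blast
  then obtain B where B: "\<And>s. s \<in> {0..L} \<Longrightarrow> \<bar>F s\<bar> \<le> B"
    unfolding bounded_iff by (metis imageI real_norm_def)
  have GB: "\<bar>G s\<bar> \<le> B" for s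
    unfolding G_def using xy by (intro B) auto
  define k where "k n = real (Suc n)" for n
  have k: "k n > 0" for n by (simp add: k_def)
  \<comment> \<open>The first term switches on over \<open>{x..x + 1 / k n}\<close>, the second
    switches off over \<open>{y..y + 1 / k n}\<close>. The support lies in
    \<open>{x..y + 1 / k n}\<close>, which fits into the open interval once
    \<open>1 / k n < L - y\<close>.\<close>
  define \<phi> where "\<phi> n s = \<psi> (k n * s + - k n * x) - \<psi> (k n * s + - k n * y)" for n s
  define \<phi>' where "\<phi>' n s = k n * deriv \<psi> (k n * s + - k n * x) - k n * deriv \<psi> (k n * s + - k n * y)" for n s
  have \<phi>_DERIV: "(\<phi> n has_real_derivative \<phi>' n s) (at s)" for n s
  proof -
    have "((\<lambda>s. \<psi> (k n * s + - k n * z)) has_real_derivative deriv \<psi> (k n * s + - k n * z) * k n) (at s)" for z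
      by (rule DERIV_chain2[OF smooth_real_DERIV[OF \<psi>(1)]]) (auto intro!: derivative_eq_intros)
    from DERIV_diff[OF this[of x] this[of y]] show ?thesis
      unfolding \<phi>_def[abs_def] \<phi>'_def by (simp add: mult.commute)
  qed
  have \<phi>_smooth: "smooth_real (\<phi> n)" for n
    unfolding \<phi>_def by (intro smooth_real_diff smooth_real_compose_affine \<psi>)
  have \<phi>'_cont: "continuous_on UNIV (\<phi>' n)" for n
    using smooth_real_continuous_on[OF smooth_real_deriv[OF \<phi>_smooth[of n]], of UNIV]
      DERIV_imp_deriv[OF \<phi>_DERIV] by (auto cong: continuous_on_cong)
  have outside: "\<phi> n s = 0" if "s \<notin> {x..y + 1 / k n}" for n s
  proof (cases "s < x")
    case True
    then have "k n * s < k n * x" "k n * s < k n * y"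
      using k[of n] xy by auto
    then show ?thesis using \<psi>(2) by (simp add: \<phi>_def)
  next
    case False
    with that have "s > y + 1 / k n" by auto
    then have "k n * s > k n * y + 1"
      using k[of n] by (simp add: field_simps)
    moreover have "k n * x < k n * y"
      using k[of n] xy by auto
    ultimately show ?thesis using \<psi>(3) by (simp add: \<phi>_def)
  qed
  have outside': "\<phi>' n s = 0" if "s \<notin> {x..y + 1 / k n}" for n s
  proof -
    have "((\<lambda>x. 0) has_real_derivative 0) (at s)" by simp
    then have "(\<phi> n has_real_derivative 0) (at s)"
      by (rule has_field_derivative_transform_within_open[where S = "- {x..y + 1 / k n}"])
        (use that outside in auto)
    with \<phi>_DERIV show ?thesis by (rule DERIV_unique)
  qed
  have "(\<lambda>n. 1 / k n) \<longlonglongrightarrow> 0"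
    unfolding k_def by (rule LIMSEQ_Suc[OF lim_const_over_n])
  then have ev: "\<forall>\<^sub>F n in sequentially. 1 / k n < L - y"
    by (rule order_tendstoD(2)) (use xy in simp)
  \<comment> \<open>The weak derivative identity for the test function \<open>\<phi> n\<close>.
    There \<open>f\<close> is exchanged for \<open>G\<close> almost everywhere, and the integral
    spreads to the whole line because \<open>\<phi>' n\<close> vanishes outside the
    interval.\<close>
  have eq: "(LINT s|lborel. G s * (k n * deriv \<psi> (k n * s + - k n * x))) -
            (LINT s|lborel. G s * (k n * deriv \<psi> (k n * s + - k n * y))) =
            - integral\<^sup>L ?M (\<lambda>s. g s * \<phi> n s)" if n: "1 / k n < L - y" for n
  proof -
    have sub: "{x..y + 1 / k n} \<subseteq> {0<..<L}"
      using n xy by auto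
    have cl: "closure {s. \<phi> n s \<noteq> 0} \<subseteq> {x..y + 1 / k n}"
      by (rule closure_minimal) (use outside in blast, simp)
    then have "bounded (closure {s. \<phi> n s \<noteq> 0})"
      using bounded_subset bounded_closed_interval by blast
    then have "\<phi> n \<in> test_functions L"
      unfolding test_functions_def using cl sub \<phi>_smooth by (auto simp: compact_eq_bounded_closed)
    then have "(LINT s:{0<..<L}|lebesgue. f s * deriv (\<phi> n) s) = - (LINT s:{0<..<L}|lebesgue. g s * \<phi> n s)"
      using weak by (simp add: has_weak_deriv_def)
    then have "- integral\<^sup>L ?M (\<lambda>s. g s * \<phi> n s) = integral\<^sup>L ?M (\<lambda>s. f s * \<phi>' n s)"
      using DERIV_imp_deriv[OF \<phi>_DERIV] by (simp add: LINT_lebesgue_on)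
    also have "\<dots> = integral\<^sup>L ?M (\<lambda>s. G s * \<phi>' n s)"
    proof (rule integral_cong_AE)
      have meas: "h \<in> borel_measurable ?M" if "continuous_on UNIV h" for h :: "real \<Rightarrow> real"
        using that by (intro continuous_imp_measurable_on_sets_lebesgue) (auto intro: continuous_on_subset)
      show "(\<lambda>s. f s * \<phi>' n s) \<in> borel_measurable ?M"
        by (intro borel_measurable_times meas \<phi>'_cont L2_borel_measurable L2)
      show "(\<lambda>s. G s * \<phi>' n s) \<in> borel_measurable ?M"
        by (intro borel_measurable_times meas \<phi>'_cont G)
      show "AE s in ?M. f s * \<phi>' n s = G s * \<phi>' n s"
        using F(2) AE_space by eventually_elim (simp add: G_eq)
    qed
    also have "\<dots> = (LINT s|lebesgue. indicator {0<..<L} s *\<^sub>R (G s * \<phi>' n s))"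
      by (simp add: integral_restrict_space)
    also have "\<dots> = (LINT s|lebesgue. G s * \<phi>' n s)"
    proof (rule Bochner_Integration.integral_cong)
      fix s
      have "s \<in> {0<..<L}" if "\<phi>' n s \<noteq> 0"
        using outside'[of s n] sub that by blast
      then show "indicator {0<..<L} s *\<^sub>R (G s * \<phi>' n s) = G s * \<phi>' n s"
        by (cases "\<phi>' n s = 0") auto
    qed simp
    also have "\<dots> = (LINT s|lborel. G s * \<phi>' n s)"
      using G \<phi>'_cont[of n] by (intro integral_completion)
        (auto intro!: borel_measurable_continuous_onI continuous_intros)
    also have "\<dots> = (LINT s|lborel. G s * (k n * deriv \<psi> (k n * s + - k n * x))
                            - G s * (k n * deriv \<psi> (k n * s + - k n * y)))"
      by (simp add: \<phi>'_def right_diff_distrib)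
    also have "\<dots> = (LINT s|lborel. G s * (k n * deriv \<psi> (k n * s + - k n * x))) -
            (LINT s|lborel. G s * (k n * deriv \<psi> (k n * s + - k n * y)))"
      by (intro Bochner_Integration.integral_diff integrable_mollifier[OF G GB] \<psi> k)
    finally show ?thesis by simp
  qed
  have lim1: "(\<lambda>n. - integral\<^sup>L ?M (\<lambda>s. g s * \<phi> n s)) \<longlonglongrightarrow> G x - G y"
  proof (rule Lim_transform_eventually)
    show "(\<lambda>n. (LINT s|lborel. G s * (k n * deriv \<psi> (k n * s + - k n * x))) -
            (LINT s|lborel. G s * (k n * deriv \<psi> (k n * s + - k n * y)))) \<longlonglongrightarrow> G x - G y"
      unfolding k_def by (intro tendsto_diff mollifier_tendsto[OF G GB] \<psi>)
    show "\<forall>\<^sub>F n in sequentially. (LINT s|lborel. G s * (k n * deriv \<psi> (k n * s + - k n * x))) -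
            (LINT s|lborel. G s * (k n * deriv \<psi> (k n * s + - k n * y))) =
            - integral\<^sup>L ?M (\<lambda>s. g s * \<phi> n s)"
      using ev by eventually_elim (rule eq)
  qed
  \<comment> \<open>The transition starts at \<open>z\<close> and lies to its right, so the limit at
    \<open>s = z\<close> is 0. Hence \<open>\<phi> n\<close> converges at every point to the
    indicator of the half-open \<open>{x<..y}\<close>.\<close>
  have \<psi>_lim: "(\<lambda>n. \<psi> (k n * s + - k n * z)) \<longlonglongrightarrow> (if s > z then 1 else 0)" for s z
  proof (cases "s > z")
    case True
    have "\<forall>\<^sub>F n in sequentially. 1 / k n < s - z"
      using \<open>(\<lambda>n. 1 / k n) \<longlonglongrightarrow> 0\<close> by (rule order_tendstoD(2)) (use True in simp)
    then have "\<forall>\<^sub>F n in sequentially. \<psi> (k n * s + - k n * z) = 1"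
    proof eventually_elim
      case (elim n)
      then show ?case
        using k[of n] by (intro \<psi>(3)) (simp add: field_simps)
    qed
    then show ?thesis using True by (simp add: tendsto_eventually)
  next
    case False
    then have "\<psi> (k n * s + - k n * z) = 0" for n
      using k[of n] by (intro \<psi>(2)) (auto simp: mult_left_mono)
    then show ?thesis using False by simp
  qed
  have meas_ind: "(\<lambda>s. g s * indicator {x<..y} s) \<in> borel_measurable ?M"
    by (intro borel_measurable_times L2_borel_measurable[OF L2(2)] borel_measurable_indicator)
      (use xy in \<open>auto simp: sets_restrict_space_iff\<close>)
  have "(\<lambda>n. integral\<^sup>L ?M (\<lambda>s. g s * \<phi> n s)) \<longlonglongrightarrow> integral\<^sup>L ?M (\<lambda>s. g s * indicator {x<..y} s)"
  proof (rule integral_dominated_convergence[OF meas_ind])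
    show "integrable ?M (\<lambda>s. \<bar>g s\<bar> * 2)"
      using L2_integrable[OF L2(2)] by simp
    show "(\<lambda>s. g s * \<phi> n s) \<in> borel_measurable ?M" for n
      using smooth_real_continuous_on[OF \<phi>_smooth[of n], of "{0<..<L}"]
      by (intro borel_measurable_times L2_borel_measurable L2 continuous_imp_measurable_on_sets_lebesgue) auto
    show "AE s in ?M. (\<lambda>n. g s * \<phi> n s) \<longlonglongrightarrow> g s * indicator {x<..y} s"
    proof (intro AE_I2 tendsto_mult tendsto_const)
      fix s
      have "(\<lambda>n. \<phi> n s) \<longlonglongrightarrow> (if s > x then 1 else 0) - (if s > y then 1 else 0)"
        unfolding \<phi>_def by (intro tendsto_diff \<psi>_lim)
      then show "(\<lambda>n. \<phi> n s) \<longlonglongrightarrow> indicator {x<..y} s"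
        by (rule back_subst[where P = "\<lambda>l. _ \<longlonglongrightarrow> l"]) (use xy in \<open>auto simp: indicator_def\<close>)
    qed
    show "AE s in ?M. norm (g s * \<phi> n s) \<le> \<bar>g s\<bar> * 2" for n
    proof (intro AE_I2)
      fix s
      have "\<bar>\<phi> n s\<bar> \<le> 2"
        unfolding \<phi>_def using \<psi>(4)[of "k n * s + - k n * x"] \<psi>(4)[of "k n * s + - k n * y"] by linarith
      then show "norm (g s * \<phi> n s) \<le> \<bar>g s\<bar> * 2"
        by (simp add: abs_mult mult_left_mono)
    qed
  qed
  \<comment> \<open>The same sequence has two limits: one from the mollifiers at \<open>x\<close>
    and \<open>y\<close>, one from dominated convergence on the side of \<open>g\<close>.\<close>
  from LIMSEQ_unique[OF lim1 tendsto_minus[OF this]]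
  have "F y - F x = integral\<^sup>L ?M (\<lambda>s. g s * indicator {x<..y} s)"
    using xy by (simp add: G_eq)
  also have "\<dots> = integral {0<..<L} (\<lambda>s. g s * indicator {x<..y} s)"
  proof (rule lebesgue_integral_eq_integral)
    show "integrable ?M (\<lambda>s. g s * indicator {x<..y} s)"
      by (rule integrable_real_mult_indicator[OF _ L2_integrable[OF L2(2)]])
        (use xy in \<open>auto simp: sets_restrict_space_iff\<close>)
  qed simp
  also have "\<dots> = integral {0<..<L} (\<lambda>s. if s \<in> {x<..y} then g s else 0)"
    by (rule integral_cong) (simp add: indicator_def)
  also have "\<dots> = integral ({0<..<L} \<inter> {x<..y}) g"
    by (simp only: integral_restrict_Int Int_commute)
  also have "{0<..<L} \<inter> {x<..y} = {x<..y}"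
    using xy by auto
  also have "integral {x<..y} g = integral {x..y} g"
    by (rule integral_spike_set) (auto intro: negligible_subset[of "{x}"])
  finally show ?thesis .
qed

text \<open>By the interior identity \<open>F\<close> minus the primitive of \<open>g\<close> is
  constant on the open interval, with reference point \<open>L / 2\<close>; continuity carries this
  to the boundary values.\<close>

lemma has_weak_deriv_imp_integral:
  assumes weak: "has_weak_deriv L f g" and rep: "continuous_rep L f F" and x: "x \<in> {0..L}"
  shows "F x = F 0 + integral {0..x} g"
proof (cases "L > 0")
  case True
  have g: "g integrable_on {0..L}"
    using weak by (auto simp: has_weak_deriv_def intro: L2_integrable_on)
  define H where "H x = F x - integral {0..x} g" for x
  have cont: "continuous_on {0..L} H"
    unfolding H_def using rep indefinite_integral_continuous_1[OF g]
    by (auto simp: continuous_rep_def intro!: continuous_intros)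
  have less: "H a = H b" if "0 < a" "a < b" "b < L" for a b
  proof -
    have "integral {0..a} g + integral {a..b} g = integral {0..b} g"
      using that by (intro Henstock_Kurzweil_Integration.integral_combine integrable_on_subinterval[OF g]) auto
    then show ?thesis
      using has_weak_deriv_imp_diff_interior[OF weak rep that] by (simp add: H_def)
  qed
  have const: "H y = H (L / 2)" if "y \<in> {0<..<L}" for y
    using that by (cases y "L / 2" rule: linorder_cases) (auto intro: less less[symmetric])
  have "H y = H (L / 2)" if y: "y \<in> {0..L}" for y
    by (rule continuous_constant_on_closure[where S = "{0<..<L}"]) (use True cont y in \<open>auto intro: const\<close>)
  from this[OF x] this[of 0] True show ?thesis
    by (simp add: H_def)
next
  case False
  with x have "x = 0" by simp
  then show ?thesis by simp
qed

text \<open>Lebesgue differentiation: at almost every point the right averages of the zero extension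
  of \<open>g\<close> converge to its value, and these averages are differences of vanishing
  primitives.\<close>

lemma AE_zero_if_integrals_zero:
  fixes g :: "real \<Rightarrow> real"
  assumes g: "integrable (lebesgue_on {0<..<L}) g"
    and zero: "\<And>x. x \<in> {0..L} \<Longrightarrow> integral {0..x} g = 0"
  shows "AE x in lebesgue_on {0<..<L}. g x = 0"
proof -
  define f where "f x = (if x \<in> {0<..<L} then g x else 0)" for x
  have gi: "g integrable_on {0<..<L}"
    by (rule integrable_on_lebesgue_on[OF g]) simp
  then have "f integrable_on UNIV"
    unfolding f_def by (simp only: integrable_restrict_UNIV)
  then have "f integrable_on cbox a b" for a b
    by (rule integrable_on_subcbox) auto
  then obtain N where N: "negligible N"
    and lim: "\<And>x e. \<lbrakk>x \<notin> N; 0 < e\<rbrakk> \<Longrightarrow> \<exists>d>0. \<forall>h. 0 < h \<and> h < d \<longrightarrow>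
                norm (integral (cbox x (x + h *\<^sub>R One)) f /\<^sub>R h ^ DIM(real) - f x) < e"
    using integrable_ccontinuous_explicit by blast
  have "g x = 0" if x: "x \<in> {0<..<L}" "x \<notin> N" for x
  proof (rule ccontr)
    assume "g x \<noteq> 0"
    \<comment> \<open>With this tolerance a vanishing average would give
      \<open>\<bar>g x\<bar> < \<bar>g x\<bar>\<close>.\<close>
    with lim[OF x(2), of "\<bar>g x\<bar>"] obtain d where d: "d > 0"
      "\<And>h. 0 < h \<Longrightarrow> h < d \<Longrightarrow> norm (integral (cbox x (x + h *\<^sub>R One)) f /\<^sub>R h ^ DIM(real) - f x) < \<bar>g x\<bar>"
      by auto
    \<comment> \<open>Small enough for the estimate and for \<open>x + h\<close> to stay below
      \<open>L\<close>.\<close>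
    define h where "h = min (d / 2) ((L - x) / 2)"
    have h: "0 < h" "h < d" "x + h < L"
      using d(1) x(1) by (auto simp: h_def min_def field_simps)
    have gi': "g integrable_on {0..L}"
      using gi by (simp add: integrable_on_open_interval_real)
    have "integral {0..x} g + integral {x..x + h} g = integral {0..x + h} g"
      using h x by (intro Henstock_Kurzweil_Integration.integral_combine integrable_on_subinterval[OF gi']) auto
    then have "integral {x..x + h} g = 0"
      using zero[of x] zero[of "x + h"] x h by simp
    moreover have "integral {x..x + h} f = integral {x..x + h} g"
      by (rule Henstock_Kurzweil_Integration.integral_cong) (use x h in \<open>auto simp: f_def\<close>)
    ultimately show False
      using d(2)[OF h(1,2)] x by (simp add: f_def)
  qed
  moreover have "AE x in lebesgue. x \<notin> N"
    using N by (simp add: negligible_iff_null_sets AE_not_in)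
  ultimately show ?thesis
    by (auto simp: AE_restrict_space_iff elim!: eventually_mono)
qed

section \<open>Weak derivatives of affine functions\<close>

lemma has_weak_deriv_weak_deriv: "f \<in> W12 L \<Longrightarrow> has_weak_deriv L f (weak_deriv L f)"
  unfolding W12_def weak_deriv_def by (auto intro: someI_ex[of "has_weak_deriv L f"])

lemma continuous_imp_integrable_lebesgue_on:
  fixes f :: "real \<Rightarrow> real"
  assumes "continuous_on {a..b} f"
  shows "integrable (lebesgue_on {a<..<b}) f"
proof -
  have "f absolutely_integrable_on {a..b}"
    using assms absolutely_integrable_continuous_real by blast
  then have "f absolutely_integrable_on {a<..<b}"
    by (rule set_integrable_subset) auto
  then show ?thesis
    by (rule absolutely_integrable_imp_integrable) simp
qed

lemma continuous_imp_L2: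
  assumes "continuous_on {0..L} f"
  shows "f \<in> L2 L"
proof -
  have "(\<lambda>x. (f x)\<^sup>2) absolutely_integrable_on {0..L}"
    using assms by (intro absolutely_integrable_continuous_real continuous_intros)
  then have "(\<lambda>x. (f x)\<^sup>2) absolutely_integrable_on {0<..<L}"
    by (rule set_integrable_subset) auto
  moreover have "f \<in> borel_measurable (lebesgue_on {0<..<L})"
    using continuous_imp_integrable_lebesgue_on[OF assms] by (rule borel_measurable_integrable)
  ultimately show ?thesis
    by (simp add: L2_def set_borel_measurable_def borel_measurable_restrict_space_iff)
qed

lemma continuous_integral_lebesgue_on:
  fixes f :: "real \<Rightarrow> real"
  assumes "continuous_on {a..b} f"
  shows "integral\<^sup>L (lebesgue_on {a<..<b}) f = integral {a..b} f"
  using lebesgue_integral_eq_integral[OF continuous_imp_integrable_lebesgue_on[OF assms]]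
  by (simp add: integral_open_interval_real)

text \<open>Integration by parts: the derivative of \<open>(a * x + b) * \<phi> x\<close> integrates
  to boundary terms, which vanish since the support of \<open>\<phi>\<close> avoids 0 and
  \<open>L\<close>.\<close>

lemma has_weak_deriv_affine:
  assumes "L > 0"
  shows "has_weak_deriv L (\<lambda>s. a * s + b) (\<lambda>s. a)"
proof -
  have "(LINT x:{0<..<L}|lebesgue. (a * x + b) * deriv \<phi> x) = - (LINT x:{0<..<L}|lebesgue. a * \<phi> x)"
    if "\<phi> \<in> test_functions L" for \<phi>
  proof -
    have \<phi>: "smooth_real \<phi>" "\<phi> 0 = 0" "\<phi> L = 0"
      using that closure_subset[of "{x. \<phi> x \<noteq> 0}"] by (auto simp: test_functions_def)
    have cont: "continuous_on {0..L} \<phi>" "continuous_on {0..L} (deriv \<phi>)"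
      using \<phi>(1) smooth_real_continuous_on smooth_real_deriv by blast+
    have "((\<lambda>x. a * \<phi> x + (a * x + b) * deriv \<phi> x) has_integral
        (a * L + b) * \<phi> L - (a * 0 + b) * \<phi> 0) {0..L}"
    proof (rule fundamental_theorem_of_calculus)
      fix x
      have "((\<lambda>x. (a * x + b) * \<phi> x) has_real_derivative a * \<phi> x + (a * x + b) * deriv \<phi> x) (at x)"
        using smooth_real_DERIV[OF \<phi>(1), of x] by (auto intro!: derivative_eq_intros)
      then show "((\<lambda>x. (a * x + b) * \<phi> x) has_vector_derivative a * \<phi> x + (a * x + b) * deriv \<phi> x)
          (at x within {0..L})"
        by (auto simp: has_real_derivative_iff_has_vector_derivative has_vector_derivative_at_within)
    qed (use assms in simp)
    then have "integral {0..L} (\<lambda>x. a * \<phi> x + (a * x + b) * deriv \<phi> x) = 0"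
      using \<phi> by (simp add: integral_unique)
    then have "integral {0..L} (\<lambda>x. a * \<phi> x) + integral {0..L} (\<lambda>x. (a * x + b) * deriv \<phi> x) = 0"
      by (subst (asm) Henstock_Kurzweil_Integration.integral_add)
        (auto intro!: integrable_continuous_real continuous_intros cont)
    then show ?thesis
      by (simp only: LINT_lebesgue_on)
        (subst (1 2) continuous_integral_lebesgue_on, auto intro!: continuous_intros cont)
  qed
  then show ?thesis
    by (auto simp: has_weak_deriv_def intro!: continuous_imp_L2 continuous_intros)
qed

text \<open>\<open>weak_deriv\<close> is picked by choice, so it is pinned down only almost
  everywhere: the chosen version and the constant \<open>a\<close> have the same primitive.\<close>

lemma weak_deriv_affine:
  assumes "L > 0"
  shows "AE s in lebesgue_on {0<..<L}. weak_deriv L (\<lambda>s. a * s + b) s = a"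
proof -
  let ?g = "weak_deriv L (\<lambda>s. a * s + b)"
  have weak: "has_weak_deriv L (\<lambda>s. a * s + b) ?g"
    using has_weak_deriv_affine[OF assms] by (intro has_weak_deriv_weak_deriv) (auto simp: W12_def)
  then have L2: "?g \<in> L2 L"
    by (simp add: has_weak_deriv_def)
  have rep: "continuous_rep L (\<lambda>s. a * s + b) (\<lambda>s. a * s + b)"
    by (auto simp: continuous_rep_def ae_eq_def intro!: continuous_intros)
  interpret finite_measure "lebesgue_on {0<..<L}"
    by (rule finite_measure_lebesgue_on_interval)
  have "AE s in lebesgue_on {0<..<L}. ?g s - a = 0"
  proof (rule AE_zero_if_integrals_zero)
    show "integrable (lebesgue_on {0<..<L}) (\<lambda>s. ?g s - a)"
      using L2_integrable[OF L2] by simp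
    show "integral {0..x} (\<lambda>s. ?g s - a) = 0" if "x \<in> {0..L}" for x
    proof -
      have "?g integrable_on {0..x}"
        by (rule integrable_on_subinterval[OF L2_integrable_on[OF L2]]) (use that in auto)
      then have "integral {0..x} (\<lambda>s. ?g s - a) = integral {0..x} ?g - a * x"
        using that by (subst Henstock_Kurzweil_Integration.integral_diff) auto
      then show ?thesis
        using has_weak_deriv_imp_integral[OF weak rep that] by simp
    qed
  qed
  then show ?thesis by simp
qed

lemma measure_lebesgue_on_interval: "L > 0 \<Longrightarrow> measure (lebesgue_on {0<..<L}) {0<..<L} = L"
  by (simp add: measure_restrict_space)

text \<open>Turns the boundary condition on \<theta> into the integral of its weak
  derivative.\<close>

lemma W12_continuous_rep_integral:
  assumes weak: "has_weak_deriv L f g" and rep: "continuous_rep L f F" and "L > 0"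
  shows "integral\<^sup>L (lebesgue_on {0<..<L}) g = F L - F 0"
proof -
  have "integrable (lebesgue_on {0<..<L}) g"
    using weak by (auto simp: has_weak_deriv_def intro: L2_integrable)
  then have "integral\<^sup>L (lebesgue_on {0<..<L}) g = integral {0..L} g"
    by (subst lebesgue_integral_eq_integral) (simp_all add: integral_open_interval_real)
  then show ?thesis
    using has_weak_deriv_imp_integral[OF weak rep, of L] \<open>L > 0\<close> by simp
qed

section \<open>A Poincare inequality in the supremum norm\<close>

text \<open>The oscillation of \<open>F\<close> is at most the integral \<open>J\<close> of
  \<open>\<bar>g s\<bar>\<close>. Averaging \<open>F x - F y\<close> over \<open>y\<close> replaces
  \<open>F y\<close> by the mean, and Cauchy-Schwarz bounds the square of \<open>J\<close>.\<close>

lemma poincare_sup: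
  assumes weak: "has_weak_deriv L f g" and rep: "continuous_rep L f F" and L: "L > 0"
    and mean: "integral\<^sup>L (lebesgue_on {0<..<L}) f = \<nu> * L"
    and x: "x \<in> {0..L}"
  shows "(F x - \<nu>)\<^sup>2 \<le> L * integral\<^sup>L (lebesgue_on {0<..<L}) (\<lambda>s. (g s)\<^sup>2)"
proof -
  let ?M = "lebesgue_on {0<..<L}"
  interpret finite_measure ?M
    by (rule finite_measure_lebesgue_on_interval)
  have M: "measure ?M {0<..<L} = L"
    using L by (rule measure_lebesgue_on_interval)
  have L2: "f \<in> L2 L" "g \<in> L2 L"
    using weak by (auto simp: has_weak_deriv_def)
  define J where "J = integral\<^sup>L ?M (\<lambda>s. \<bar>g s\<bar>)"
  have abs: "integrable ?M (\<lambda>s. \<bar>g s\<bar>)"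
    using L2_integrable[OF L2(2)] by simp
  then have J: "J = integral {0..L} (\<lambda>s. \<bar>g s\<bar>)"
    unfolding J_def by (subst lebesgue_integral_eq_integral) (simp_all add: integral_open_interval_real)
  have gi: "g integrable_on {0..L}"
    by (rule L2_integrable_on[OF L2(2)])
  have absi: "(\<lambda>s. \<bar>g s\<bar>) integrable_on {0..L}"
    using integrable_on_lebesgue_on[OF abs] by (simp add: integrable_on_open_interval_real)
  have less: "\<bar>F b - F a\<bar> \<le> J" if "0 \<le> a" "a \<le> b" "b \<le> L" for a b
  proof -
    have sub: "g integrable_on {a..b}" "(\<lambda>s. \<bar>g s\<bar>) integrable_on {a..b}"
      using that by (auto intro: integrable_on_subinterval[OF gi] integrable_on_subinterval[OF absi])
    have "integral {0..a} g + integral {a..b} g = integral {0..b} g"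
      using that by (intro Henstock_Kurzweil_Integration.integral_combine integrable_on_subinterval[OF gi]) auto
    then have "F b - F a = integral {a..b} g"
      using has_weak_deriv_imp_integral[OF weak rep, of a] has_weak_deriv_imp_integral[OF weak rep, of b] that
      by simp
    moreover have "norm (integral {a..b} g) \<le> integral {a..b} (\<lambda>s. \<bar>g s\<bar>)"
      by (rule Henstock_Kurzweil_Integration.integral_norm_bound_integral) (use sub in auto)
    moreover have "integral {a..b} (\<lambda>s. \<bar>g s\<bar>) \<le> J"
      unfolding J by (rule integral_subset_le) (use that sub absi in auto)
    ultimately show ?thesis by simp
  qed
  have osc: "\<bar>F x - F y\<bar> \<le> J" if "y \<in> {0..L}" for y
    using less[of x y] less[of y x] that x by (cases "x \<le> y") (auto simp: abs_minus_commute)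
  have F: "continuous_on {0..L} F" "AE s in ?M. f s = F s"
    using rep by (auto simp: continuous_rep_def ae_eq_lebesgue_on)
  have Fi: "integrable ?M F"
    by (rule continuous_imp_integrable_lebesgue_on[OF F(1)])
  have "integral\<^sup>L ?M F = \<nu> * L"
    using integral_cong_AE[OF L2_borel_measurable[OF L2(1)] borel_measurable_integrable[OF Fi] F(2)] mean by simp
  then have "integral\<^sup>L ?M (\<lambda>y. F x - F y) = (F x - \<nu>) * L"
    using Fi M by (simp add: algebra_simps)
  moreover have "\<bar>integral\<^sup>L ?M (\<lambda>y. F x - F y)\<bar> \<le> integral\<^sup>L ?M (\<lambda>y. J)"
    by (rule integral_abs_bound_integral) (use Fi osc in auto)
  ultimately have "\<bar>F x - \<nu>\<bar> * L \<le> J * L"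
    using M L by (simp add: abs_mult mult.commute)
  then have "\<bar>F x - \<nu>\<bar> \<le> J"
    using L by simp
  then have "(F x - \<nu>)\<^sup>2 \<le> J\<^sup>2"
    by (metis abs_ge_zero power2_abs power_mono)
  also have "J\<^sup>2 \<le> L * integral\<^sup>L ?M (\<lambda>s. (g s)\<^sup>2)"
  proof -
    \<comment> \<open>Cauchy-Schwarz by hand: the squared deviation of
      \<open>\<bar>g s\<bar>\<close> from its mean \<open>J / L\<close> has nonnegative
      integral.\<close>
    have "0 \<le> integral\<^sup>L ?M (\<lambda>s. (\<bar>g s\<bar> - J / L)\<^sup>2)"
      by simp
    also have "(\<lambda>s. (\<bar>g s\<bar> - J / L)\<^sup>2) = (\<lambda>s. ((g s)\<^sup>2 - (2 * (J / L)) * \<bar>g s\<bar>) + (J / L)\<^sup>2)"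
      by (auto simp: power2_eq_square algebra_simps)
    also have "integral\<^sup>L ?M \<dots> = integral\<^sup>L ?M (\<lambda>s. (g s)\<^sup>2) - (2 * (J / L)) * J + (J / L)\<^sup>2 * L"
      using L2_square_integrable[OF L2(2)] abs M by (simp add: J_def)
    also have "\<dots> = integral\<^sup>L ?M (\<lambda>s. (g s)\<^sup>2) - J\<^sup>2 / L"
      using L by (simp add: power2_eq_square field_simps)
    finally show ?thesis
      using L by (simp add: field_simps)
  qed
  finally show ?thesis .
qed

section \<open>The energy estimate\<close>

text \<open>Taylor with Lagrange remainder, the second derivative being bounded on a compact
  interval. It will be applied to the reciprocal of \<beta> at \<nu>.\<close>

lemma smooth_real_le_second_order:
  assumes "smooth_real f"
  obtains C where "C \<ge> 0" "\<And>x. \<bar>x - c\<bar> \<le> r \<Longrightarrow> f x \<le> f c + deriv f c * (x - c) + C * (x - c)\<^sup>2"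
proof -
  have "continuous_on {c - r..c + r} (deriv (deriv f))"
    using assms smooth_real_deriv smooth_real_continuous_on by blast
  then have "bounded (deriv (deriv f) ` {c - r..c + r})"
    using compact_continuous_image compact_imp_bounded by blast
  then obtain K where K: "\<And>x. x \<in> {c - r..c + r} \<Longrightarrow> \<bar>deriv (deriv f) x\<bar> \<le> K"
    unfolding bounded_iff by (metis imageI real_norm_def)
  show thesis
  proof
    \<comment> \<open>The absolute value keeps the constant nonnegative even if the interval is
      empty and \<open>K\<close> arbitrary. The factor 1/2 of the remainder is given away.\<close>
    show "\<bar>K\<bar> \<ge> 0" by simp
    fix x assume x: "\<bar>x - c\<bar> \<le> r"
    show "f x \<le> f c + deriv f c * (x - c) + \<bar>K\<bar> * (x - c)\<^sup>2"
    proof (cases "x = c")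
      case False
      have "\<exists>t. (if x < c then x < t \<and> t < c else c < t \<and> t < x) \<and>
          f x = (\<Sum>m<2. ((deriv ^^ m) f c / fact m) * (x - c)^m) + ((deriv ^^ 2) f t / fact 2) * (x - c)^2"
      proof (rule Taylor[where a = "c - r" and b = "c + r"])
        show "\<forall>m t. m < 2 \<and> c - r \<le> t \<and> t \<le> c + r \<longrightarrow>
            ((deriv ^^ m) f has_real_derivative (deriv ^^ Suc m) f t) (at t)"
          using assms DERIV_deriv_iff_real_differentiable by (auto simp: smooth_real_def)
      qed (use x False in auto)
      then obtain t where "if x < c then x < t \<and> t < c else c < t \<and> t < x"
        and fx: "f x = f c + deriv f c * (x - c) + (deriv (deriv f) t / 2) * (x - c)\<^sup>2"
        by (auto simp: numeral_2_eq_2)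
      then have t: "t \<in> {c - r..c + r}"
        using x by (auto split: if_splits)
      have "deriv (deriv f) t / 2 \<le> \<bar>K\<bar>"
        using K[OF t] by linarith
      then have "(deriv (deriv f) t / 2) * (x - c)\<^sup>2 \<le> \<bar>K\<bar> * (x - c)\<^sup>2"
        by (rule mult_right_mono) simp
      with fx show ?thesis by simp
    qed simp
  qed
qed

section \<open>Energy of the critical point, and integrability of the energy density\<close>

lemma energy_theta_c_rho_c:
  assumes L: "L > 0"
  shows "energy L \<beta> c\<^sub>0 \<mu> (theta_c L \<omega>, rho_c \<nu>) = 1 / 2 * (\<beta> \<nu> * (2 * pi * of_int \<omega> / L - c\<^sub>0)\<^sup>2 * L)"
proof -
  let ?M = "lebesgue_on {0<..<L}" and ?\<kappa> = "2 * pi * of_int \<omega> / L"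
  have meas: "weak_deriv L (\<lambda>s. a * s + b) \<in> borel_measurable ?M" for a b
  proof -
    have "(\<lambda>s. a * s + b) \<in> W12 L"
      unfolding W12_def using has_weak_deriv_affine[OF L] by blast
    then have "weak_deriv L (\<lambda>s. a * s + b) \<in> L2 L"
      using has_weak_deriv_weak_deriv by (simp add: has_weak_deriv_def)
    then show ?thesis
      by (rule L2_borel_measurable)
  qed
  \<comment> \<open>Puts both components into the affine form of \<open>weak_deriv_affine\<close>,
    \<open>rho_c\<close> with slope 0.\<close>
  have eq: "theta_c L \<omega> = (\<lambda>s. ?\<kappa> * s + 0)" "rho_c \<nu> = (\<lambda>s. 0 * s + \<nu>)"
    by (auto simp: theta_c_def rho_c_def)
  have rho: "\<beta> (rho_c \<nu> s) = \<beta> \<nu>" for s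
    by (simp add: rho_c_def)
  have "integral\<^sup>L ?M (\<lambda>s. \<beta> (rho_c \<nu> s) * (weak_deriv L (theta_c L \<omega>) s - c\<^sub>0)\<^sup>2
          + \<mu> * (weak_deriv L (rho_c \<nu>) s)\<^sup>2) = integral\<^sup>L ?M (\<lambda>s. \<beta> \<nu> * (?\<kappa> - c\<^sub>0)\<^sup>2)"
  proof (rule integral_cong_AE)
    have [measurable]: "weak_deriv L (theta_c L \<omega>) \<in> borel_measurable ?M" "weak_deriv L (rho_c \<nu>) \<in> borel_measurable ?M"
      unfolding eq by (rule meas)+
    show "(\<lambda>s. \<beta> (rho_c \<nu> s) * (weak_deriv L (theta_c L \<omega>) s - c\<^sub>0)\<^sup>2
          + \<mu> * (weak_deriv L (rho_c \<nu>) s)\<^sup>2) \<in> borel_measurable ?M"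
      unfolding rho by measurable
    have "AE s in ?M. weak_deriv L (theta_c L \<omega>) s = ?\<kappa>" "AE s in ?M. weak_deriv L (rho_c \<nu>) s = 0"
      unfolding eq by (rule weak_deriv_affine[OF L])+
    then show "AE s in ?M. \<beta> (rho_c \<nu> s) * (weak_deriv L (theta_c L \<omega>) s - c\<^sub>0)\<^sup>2
          + \<mu> * (weak_deriv L (rho_c \<nu>) s)\<^sup>2 = \<beta> \<nu> * (?\<kappa> - c\<^sub>0)\<^sup>2"
      by eventually_elim (simp add: rho_c_def)
  qed simp
  then show ?thesis
    by (simp add: energy_def LINT_lebesgue_on measure_lebesgue_on_interval[OF L])
qed

text \<open>\<rho> agrees almost everywhere with a continuous function on a compact interval, so
  \<open>\<beta> (\<rho> s)\<close> is essentially bounded and the density is dominated by squares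
  of L2 functions. Comparing energies through integrals relies on this: a non-integrable density
  would have integral 0 by default.\<close>

lemma integrable_energy_density:
  assumes \<beta>: "continuous_on UNIV \<beta>" and \<theta>: "\<theta> \<in> W12 L" and \<rho>: "\<rho> \<in> W12 L" and rep: "continuous_rep L \<rho> R"
  shows "integrable (lebesgue_on {0<..<L})
    (\<lambda>s. \<beta> (\<rho> s) * (weak_deriv L \<theta> s - c\<^sub>0)\<^sup>2 + \<mu> * (weak_deriv L \<rho> s)\<^sup>2)"
proof -
  let ?M = "lebesgue_on {0<..<L}"
  interpret finite_measure ?M
    by (rule finite_measure_lebesgue_on_interval)
  have L2: "\<rho> \<in> L2 L" "weak_deriv L \<theta> \<in> L2 L" "weak_deriv L \<rho> \<in> L2 L"
    using has_weak_deriv_weak_deriv[OF \<theta>] has_weak_deriv_weak_deriv[OF \<rho>] by (auto simp: has_weak_deriv_def)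
  note [measurable] = L2[THEN L2_borel_measurable]
  have [measurable]: "\<beta> \<in> borel_measurable borel"
    using \<beta> by (rule borel_measurable_continuous_onI)
  have R: "continuous_on {0..L} R" "AE s in ?M. \<rho> s = R s"
    using rep by (auto simp: continuous_rep_def ae_eq_lebesgue_on)
  have "compact ((\<lambda>s. \<beta> (R s)) ` {0..L})"
    by (intro compact_continuous_image continuous_on_compose2[OF \<beta> R(1)]) auto
  then obtain K where K: "\<And>s. s \<in> {0..L} \<Longrightarrow> \<bar>\<beta> (R s)\<bar> \<le> K"
    unfolding compact_eq_bounded_closed bounded_iff by (metis imageI real_norm_def)
  have sq: "integrable ?M (\<lambda>s. (weak_deriv L \<theta> s - c\<^sub>0)\<^sup>2)"
    using L2_square_integrable[OF L2(2)] L2_integrable[OF L2(2)] by (simp add: power2_diff)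
  have "integrable ?M (\<lambda>s. \<beta> (\<rho> s) * (weak_deriv L \<theta> s - c\<^sub>0)\<^sup>2)"
  proof (rule Bochner_Integration.integrable_bound)
    show "integrable ?M (\<lambda>s. K * (weak_deriv L \<theta> s - c\<^sub>0)\<^sup>2)"
      using sq by simp
    show "AE s in ?M. norm (\<beta> (\<rho> s) * (weak_deriv L \<theta> s - c\<^sub>0)\<^sup>2) \<le> norm (K * (weak_deriv L \<theta> s - c\<^sub>0)\<^sup>2)"
      using R(2) AE_space
    proof eventually_elim
      case (elim s)
      then have "\<bar>\<beta> (\<rho> s)\<bar> \<le> \<bar>K\<bar>"
        using K[of s] by auto
      then show ?case
        by (simp add: abs_mult mult_right_mono)
    qed
  qed measurable
  then show ?thesis
    using L2_square_integrable[OF L2(3)] by simp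
qed

section \<open>Comparison of the critical point with a competitor\<close>

text \<open>Completing the square. The point of tangency \<open>t / b\<close> moves with
  \<open>b\<close> so that the slope \<open>2 * t\<close> does not; the term linear in
  \<open>p\<close> then has a prescribed integral.\<close>

lemma tangent_le:
  fixes b p t :: real
  assumes "b > 0"
  shows "2 * t * p - t\<^sup>2 * inverse b \<le> b * p\<^sup>2"
proof -
  have "0 \<le> (b * p - t)\<^sup>2 / b"
    using assms by simp
  also have "\<dots> = b * p\<^sup>2 - 2 * t * p + t\<^sup>2 * inverse b"
    using assms by (simp add: power2_eq_square field_simps)
  finally show ?thesis by simp
qed

theorem proposition2p6:
  fixes L \<nu> c\<^sub>0 :: real and \<omega> :: int and \<beta> :: "real \<Rightarrow> real"
  assumes "L > 0"
    and "smooth_real \<beta>"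
    and "\<And>x. \<beta> x > 0"
    and "\<omega> \<noteq> 0"
  shows "\<exists>\<mu>\<^sub>0>0. \<forall>\<mu>\<ge>\<mu>\<^sub>0. \<forall>\<theta> \<rho>.
           (\<theta>, \<rho>) \<in> admissible L \<nu> \<omega> \<and>
           (LINT s:{0<..<L}|lebesgue. \<theta> s) = pi * of_int \<omega> * L \<and>
           \<not> (ae_eq L \<theta> (theta_c L \<omega>) \<and> ae_eq L \<rho> (rho_c \<nu>)) \<longrightarrow>
           energy L \<beta> c\<^sub>0 \<mu> (theta_c L \<omega>, rho_c \<nu>) < energy L \<beta> c\<^sub>0 \<mu> (\<theta>, \<rho>)"
proof -
  let ?M = "lebesgue_on {0<..<L}"
  note L = \<open>L > 0\<close>
  interpret finite_measure ?M
    by (rule finite_measure_lebesgue_on_interval)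
  have M: "measure ?M {0<..<L} = L"
    using L by (rule measure_lebesgue_on_interval)
  define A where "A = 2 * pi * of_int \<omega> / L - c\<^sub>0"
  \<comment> \<open>Half the slope of the tangent that touches at \<open>p = A\<close> when \<rho> =
    \<nu>, so the bound is sharp at the critical point.\<close>
  define t where "t = \<beta> \<nu> * A"
  define g where "g x = inverse (\<beta> x)" for x
  have "smooth_real g"
    unfolding g_def using assms(2,3) by (intro smooth_real_inverse) (simp_all add: less_imp_neq[symmetric])
  then obtain C where C: "C \<ge> 0"
    "\<And>x. \<bar>x - \<nu>\<bar> \<le> sqrt L \<Longrightarrow> g x \<le> g \<nu> + deriv g \<nu> * (x - \<nu>) + C * (x - \<nu>)\<^sup>2"
    using smooth_real_le_second_order by blast
  \<comment> \<open>Hence \<open>2 * t * A - t\<^sup>2 * g \<nu>\<close> is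
    \<open>\<beta> \<nu> * A\<^sup>2\<close>: the terms of order zero recover the critical energy
    density.\<close>
  have tg: "t\<^sup>2 * g \<nu> = \<beta> \<nu> * A\<^sup>2" "t * A = \<beta> \<nu> * A\<^sup>2"
    using assms(3)[of \<nu>] by (simp_all add: t_def g_def power2_eq_square)
  \<comment> \<open>The first summand absorbs the quadratic Taylor term, one factor \<open>L\<close>
    coming from Poincare and one from the length of the interval. The second covers twice the
    critical energy when \<open>D > 1\<close>. The 1 makes both comparisons strict.\<close>
  define \<mu>\<^sub>0 where "\<mu>\<^sub>0 = t\<^sup>2 * C * L\<^sup>2 + \<beta> \<nu> * A\<^sup>2 * L + 1"
  have nonneg: "t\<^sup>2 * C * L\<^sup>2 \<ge> 0" "\<beta> \<nu> * A\<^sup>2 * L \<ge> 0"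
    using C(1) L assms(3)[of \<nu>] by simp_all
  then have "\<mu>\<^sub>0 > 0"
    by (simp add: \<mu>\<^sub>0_def)
  moreover have "energy L \<beta> c\<^sub>0 \<mu> (theta_c L \<omega>, rho_c \<nu>) < energy L \<beta> c\<^sub>0 \<mu> (\<theta>, \<rho>)"
    if \<mu>: "\<mu> \<ge> \<mu>\<^sub>0" and adm: "(\<theta>, \<rho>) \<in> admissible L \<nu> \<omega>"
      and mean\<theta>: "(LINT s:{0<..<L}|lebesgue. \<theta> s) = pi * of_int \<omega> * L"
      and ne: "\<not> (ae_eq L \<theta> (theta_c L \<omega>) \<and> ae_eq L \<rho> (rho_c \<nu>))" for \<mu> \<theta> \<rho>
  proof -
    obtain \<Theta> R where W: "\<theta> \<in> W12 L" "\<rho> \<in> W12 L"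
      and \<Theta>: "continuous_rep L \<theta> \<Theta>" "\<Theta> L - \<Theta> 0 = 2 * pi * of_int \<omega>"
      and R: "continuous_rep L \<rho> R"
      and mean\<rho>: "(LINT s:{0<..<L}|lebesgue. \<rho> s) = \<nu> * L"
      using adm by (auto simp: admissible_def)
    define h where "h = weak_deriv L \<rho>"
    define p where "p s = weak_deriv L \<theta> s - c\<^sub>0" for s
    define D where "D = integral\<^sup>L ?M (\<lambda>s. (h s)\<^sup>2)"
    \<comment> \<open>Twice the energy of the competitor.\<close>
    define E where "E = integral\<^sup>L ?M (\<lambda>s. \<beta> (\<rho> s) * (p s)\<^sup>2 + \<mu> * (h s)\<^sup>2)"
    have weak: "has_weak_deriv L \<theta> (weak_deriv L \<theta>)" "has_weak_deriv L \<rho> h"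
      unfolding h_def by (intro has_weak_deriv_weak_deriv W)+
    then have L2: "\<theta> \<in> L2 L" "weak_deriv L \<theta> \<in> L2 L" "\<rho> \<in> L2 L" "h \<in> L2 L"
      by (auto simp: has_weak_deriv_def)
    have int: "integrable ?M (\<lambda>s. \<beta> (\<rho> s) * (p s)\<^sup>2 + \<mu> * (h s)\<^sup>2)"
      unfolding p_def h_def using smooth_real_continuous_on[OF assms(2)] W R by (intro integrable_energy_density)
    have pi: "integrable ?M p" "integrable ?M (\<lambda>s. (p s)\<^sup>2)"
      unfolding p_def using L2_square_integrable[OF L2(2)] L2_integrable[OF L2(2)]
      by (simp_all add: power2_diff)
    have p_int: "integral\<^sup>L ?M p = A * L"
      unfolding p_def using W12_continuous_rep_integral[OF weak(1) \<Theta>(1) L] \<Theta>(2) L2_integrable[OF L2(2)] M L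
      by (simp add: A_def field_simps)
    have \<rho>_int: "integral\<^sup>L ?M \<rho> = \<nu> * L"
      using mean\<rho> by (simp add: LINT_lebesgue_on)
    have \<mu>_pos: "\<mu> > 0"
      using \<mu> \<open>\<mu>\<^sub>0 > 0\<close> by simp
    have "D \<ge> 0"
      by (simp add: D_def)
    have AE_R: "AE s in ?M. \<rho> s = R s"
      using R by (simp add: continuous_rep_def ae_eq_lebesgue_on)
    have dev: "AE s in ?M. (\<rho> s - \<nu>)\<^sup>2 \<le> L * D"
      using AE_R AE_space
    proof eventually_elim
      case (elim s)
      then show ?case
        using poincare_sup[OF weak(2) R L \<rho>_int, of s] by (simp add: D_def)
    qed
    have "\<beta> \<nu> * A\<^sup>2 * L < E"
    proof -
      \<comment> \<open>Strictness comes from \<theta> if \<open>D = 0\<close>, from the surplus of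
        \<mu> over the Taylor constant if \<open>0 < D \<le> 1\<close>, and from
        \<open>\<mu> * D\<close> alone if \<open>D > 1\<close>.\<close>
      consider "D = 0" | "0 < D" "D \<le> 1" | "D > 1"
        using \<open>D \<ge> 0\<close> by linarith
      then show ?thesis
      proof cases
        case 1
        have \<rho>_const: "AE s in ?M. \<rho> s = \<nu>"
          using dev by eventually_elim (simp add: 1)
        have h0: "AE s in ?M. (h s)\<^sup>2 = 0"
          using 1 L2_square_integrable[OF L2(4)] integral_nonneg_eq_0_iff_AE[of ?M "\<lambda>s. (h s)\<^sup>2"]
          by (simp add: D_def)
        have "E = integral\<^sup>L ?M (\<lambda>s. \<beta> \<nu> * (p s)\<^sup>2)"
          unfolding E_def
        proof (rule integral_cong_AE)
          show "AE s in ?M. \<beta> (\<rho> s) * (p s)\<^sup>2 + \<mu> * (h s)\<^sup>2 = \<beta> \<nu> * (p s)\<^sup>2"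
            using \<rho>_const h0 by eventually_elim simp
        qed (use int pi in \<open>auto intro: borel_measurable_integrable\<close>)
        then have E: "E = \<beta> \<nu> * integral\<^sup>L ?M (\<lambda>s. (p s)\<^sup>2)"
          by simp
        have sq_int: "integrable ?M (\<lambda>s. (p s - A)\<^sup>2)"
          using pi by (simp add: power2_diff)
        have var: "integral\<^sup>L ?M (\<lambda>s. (p s - A)\<^sup>2) = integral\<^sup>L ?M (\<lambda>s. (p s)\<^sup>2) - A\<^sup>2 * L"
          using pi p_int M by (simp add: power2_diff) (simp add: power2_eq_square)
        \<comment> \<open>By \<open>var\<close> this variance, times \<open>\<beta> \<nu>\<close>,
          is the excess of \<open>E\<close> over the critical value. If it vanished, \<theta> would
          be \<open>theta_c\<close> up to an additive constant, which the prescribed mean makes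
          zero.\<close>
        have "integral\<^sup>L ?M (\<lambda>s. (p s - A)\<^sup>2) \<noteq> 0"
        proof
          assume "integral\<^sup>L ?M (\<lambda>s. (p s - A)\<^sup>2) = 0"
          then have "AE s in ?M. (p s - A)\<^sup>2 = 0"
            using sq_int integral_nonneg_eq_0_iff_AE[of ?M "\<lambda>s. (p s - A)\<^sup>2"] by simp
          then have \<theta>': "AE s in ?M. weak_deriv L \<theta> s = 2 * pi * of_int \<omega> / L"
            by eventually_elim (simp add: p_def A_def)
          have \<Theta>_eq: "\<Theta> x = \<Theta> 0 + theta_c L \<omega> x" if x: "x \<in> {0..L}" for x
          proof -
            have "AE s in lebesgue. s \<in> {0<..<L} \<longrightarrow> weak_deriv L \<theta> s = 2 * pi * of_int \<omega> / L"
              using \<theta>' by (simp add: AE_restrict_space_iff)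
            then obtain N where N: "negligible N"
              "{s. \<not> (s \<in> {0<..<L} \<longrightarrow> weak_deriv L \<theta> s = 2 * pi * of_int \<omega> / L)} \<subseteq> N"
              unfolding eventually_ae_filter by (auto simp: negligible_iff_null_sets)
            have eq: "weak_deriv L \<theta> s = 2 * pi * of_int \<omega> / L" if "s \<in> {0<..<L}" "s \<notin> N" for s
              using N(2) that by blast
            \<comment> \<open>The exceptional set also takes in 0 and \<open>L\<close>, since the
              almost everywhere statement concerns the open interval.\<close>
            have "integral {0..x} (weak_deriv L \<theta>) = integral {0..x} (\<lambda>s. 2 * pi * of_int \<omega> / L)"
              by (rule integral_spike[where S = "insert 0 (insert L N)"]) (use N(1) x in \<open>auto simp: eq\<close>)
            then show ?thesis
              using has_weak_deriv_imp_integral[OF weak(1) \<Theta>(1) x] x by (simp add: theta_c_def)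
          qed
          have \<Theta>_AE: "AE s in ?M. \<theta> s = \<Theta> 0 + theta_c L \<omega> s"
          proof -
            have "AE s in ?M. \<theta> s = \<Theta> s"
              using \<Theta>(1) by (simp add: continuous_rep_def ae_eq_lebesgue_on)
            then show ?thesis
              using AE_space
            proof eventually_elim
              case (elim s)
              then show ?case
                using \<Theta>_eq[of s] by simp
            qed
          qed
          have cont: "continuous_on {0..L} (theta_c L \<omega>)"
            unfolding theta_c_def by (intro continuous_intros)
          have "integral\<^sup>L ?M \<theta> = integral\<^sup>L ?M (\<lambda>s. \<Theta> 0 + theta_c L \<omega> s)"
            using \<Theta>_AE L2_borel_measurable[OF L2(1)] continuous_imp_integrable_lebesgue_on[OF cont]
            by (intro integral_cong_AE) (auto intro: borel_measurable_integrable)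
          also have "\<dots> = \<Theta> 0 * L + integral {0..L} (theta_c L \<omega>)"
            using continuous_imp_integrable_lebesgue_on[OF cont] continuous_integral_lebesgue_on[OF cont] M by simp
          \<comment> \<open>This is the prescribed mean of \<theta>, so
            \<open>\<Theta> 0 * L\<close> must be 0.\<close>
          also have "integral {0..L} (theta_c L \<omega>) = pi * of_int \<omega> * L"
            using has_integral_mult_right[OF ident_has_integral[of 0 L], of "2 * pi * of_int \<omega> / L"] L
            by (simp add: theta_c_def integral_unique power2_eq_square)
          finally have "\<Theta> 0 = 0"
            using mean\<theta> L by (simp add: LINT_lebesgue_on)
          then have "ae_eq L \<theta> (theta_c L \<omega>)"
            using \<Theta>_AE by (simp add: ae_eq_lebesgue_on)
          moreover have "ae_eq L \<rho> (rho_c \<nu>)"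
            using \<rho>_const by (simp add: ae_eq_lebesgue_on rho_c_def)
          ultimately show False
            using ne by simp
        qed
        moreover have "integral\<^sup>L ?M (\<lambda>s. (p s - A)\<^sup>2) \<ge> 0"
          by simp
        ultimately have "A\<^sup>2 * L < integral\<^sup>L ?M (\<lambda>s. (p s)\<^sup>2)"
          unfolding var by linarith
        then show ?thesis
          using assms(3)[of \<nu>] by (simp add: E)
      next
        case 2
        \<comment> \<open>A pointwise minorant: tangent bound, then Taylor bound, with the squared
          deviation of \<rho> already replaced by its uniform bound \<open>L * D\<close>. What
          remains is affine in \<open>p s\<close> and \<open>\<rho> s\<close> apart from the term in
          \<open>h s\<close>, so its integral is computed exactly.\<close>
        define lower where "lower s = (2 * t) * p s + ((- (t\<^sup>2 * deriv g \<nu>)) * \<rho> s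
            + (t\<^sup>2 * deriv g \<nu> * \<nu> - t\<^sup>2 * g \<nu> - t\<^sup>2 * C * L * D)) + \<mu> * (h s)\<^sup>2" for s
        have lower_int: "integrable ?M lower"
          unfolding lower_def using pi L2_integrable[OF L2(3)] L2_square_integrable[OF L2(4)] by simp
        have "integral\<^sup>L ?M lower = \<beta> \<nu> * A\<^sup>2 * L + (\<mu> - t\<^sup>2 * C * L\<^sup>2) * D"
        proof -
          have "integral\<^sup>L ?M lower = 2 * t * (A * L) + ((- (t\<^sup>2 * deriv g \<nu>)) * (\<nu> * L)
            + (t\<^sup>2 * deriv g \<nu> * \<nu> - t\<^sup>2 * g \<nu> - t\<^sup>2 * C * L * D) * L) + \<mu> * D"
            unfolding lower_def D_def using pi(1) L2_integrable[OF L2(3)] L2_square_integrable[OF L2(4)] p_int \<rho>_int M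
            by simp
          \<comment> \<open>The two terms with \<open>deriv g \<nu>\<close> cancel because \<rho>
            has mean \<nu>.\<close>
          also have "\<dots> = (2 * (t * A) - t\<^sup>2 * g \<nu>) * L + (\<mu> - t\<^sup>2 * C * L\<^sup>2) * D"
            by (simp add: algebra_simps power2_eq_square)
          finally show ?thesis
            by (simp add: tg)
        qed
        moreover have "integral\<^sup>L ?M lower \<le> E"
          unfolding E_def
        proof (rule integral_mono_AE[OF lower_int int])
          show "AE s in ?M. lower s \<le> \<beta> (\<rho> s) * (p s)\<^sup>2 + \<mu> * (h s)\<^sup>2"
            using dev
          proof eventually_elim
            case (elim s)
            have "L * D \<le> L"
              using 2 L by simp
            with elim have "(\<rho> s - \<nu>)\<^sup>2 \<le> L"
              by linarith
            then have "\<bar>\<rho> s - \<nu>\<bar> \<le> sqrt L"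
              by (metis real_sqrt_abs real_sqrt_le_iff)
            then have "g (\<rho> s) \<le> g \<nu> + deriv g \<nu> * (\<rho> s - \<nu>) + C * (\<rho> s - \<nu>)\<^sup>2"
              by (rule C(2))
            also have "C * (\<rho> s - \<nu>)\<^sup>2 \<le> C * (L * D)"
              using elim C(1) by (rule mult_left_mono)
            finally have "t\<^sup>2 * g (\<rho> s) \<le> t\<^sup>2 * (g \<nu> + deriv g \<nu> * (\<rho> s - \<nu>) + C * (L * D))"
              by (simp add: mult_left_mono)
            then show ?case
              using tangent_le[OF assms(3), of t "p s" "\<rho> s"] by (simp add: lower_def g_def algebra_simps)
          qed
        qed
        moreover have "(\<mu> - t\<^sup>2 * C * L\<^sup>2) * D > 0"
          using 2 \<mu> nonneg by (intro mult_pos_pos) (auto simp: \<mu>\<^sub>0_def)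
        ultimately show ?thesis by linarith
      next
        case 3
        have "\<beta> \<nu> * A\<^sup>2 * L < \<mu>"
          using \<mu> nonneg by (simp add: \<mu>\<^sub>0_def)
        also have "\<mu> < \<mu> * D"
          using 3 \<mu>_pos by simp
        also have "\<mu> * D = integral\<^sup>L ?M (\<lambda>s. \<mu> * (h s)\<^sup>2)"
          by (simp add: D_def)
        \<comment> \<open>The term with \<beta> is nonnegative and is dropped.\<close>
        also have "\<dots> \<le> E"
          unfolding E_def using L2_square_integrable[OF L2(4)] int less_imp_le[OF assms(3)]
          by (intro integral_mono) auto
        finally show ?thesis .
      qed
    qed
    moreover have "energy L \<beta> c\<^sub>0 \<mu> (\<theta>, \<rho>) = 1 / 2 * E"
      by (simp add: energy_def E_def LINT_lebesgue_on p_def h_def)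
    ultimately show ?thesis
      using energy_theta_c_rho_c[OF L, of \<beta> c\<^sub>0 \<mu> \<omega> \<nu>] by (simp add: A_def)
  qed
  ultimately show ?thesis by blast
qed

end
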